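(* Let $L$ be an MV-algebra and $a\in B(L)$. Then the MV-algebras $(Fix_{d_a}(L),\oplus,\neg_1,0,a)$ and $(Fix_{g_{a^\ast}}(L),\oplus,\circ_2,a^\ast,1)$ are isomorphic.
   Context: An MV-algebra is an algebra $(L,\oplus,{}^\ast,0)$ of type $(2,1,0)$ such that $(L,\oplus,0)$ is a commutative monoid, $(x^\ast)^\ast=x$, $0^\ast\oplus x=0^\ast$, and $(x^\ast\oplus y)^\ast\oplus y=(y^\ast\oplus x)^\ast\oplus x$ for all $x,y\in L$. Put $1=0^\ast$, $x\odot y=(x^\ast\oplus y^\ast)^\ast$, $x\rightarrow y=x^\ast\oplus y$. The Boolean center is $B(L)=\{a\in L\mid a\oplus a=a\}$. For $a\in L$ define maps $L\to L$ by $d_a(x)=x\odot a$ and $g_{a^\ast}(x)=a\rightarrow x=a^\ast\oplus x$. For a map $f:L\to L$, $Fix_f(L)=\{x\in L\mid f(x)=x\}$. For $a\in B(L)$: $(Fix_{d_a}(L),\oplus,\neg_1,0,a)$ is the MV-algebra with the addition $\oplus$ of $L$, negation $\neg_1x=d_a(x^\ast)$, zero element $0$ and unit (top) $a$; $(Fix_{g_{a^\ast}}(L),\oplus,\circ_2,a^\ast,1)$ is the MV-algebra with the addition $\oplus$ of $L$, negation $x^{\circ_2}=g_{a^\ast}(x^\ast)$, zero element $a^\ast$ and unit (top) $1$. *)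

theory Defs
  imports "HOL-Algebra.Congruence"
begin

record 'a mv_struct = "'a partial_object" +
  mv_add :: "'a \<Rightarrow> 'a \<Rightarrow> 'a" (infixl \<open>\<oplus>\<index>\<close> 65)
  mv_neg :: "'a \<Rightarrow> 'a" (\<open>\<sim>\<index> _\<close> [81] 80)
  mv_zero :: 'a (\<open>\<zero>\<index>\<close>)

locale mv_algebra =
  fixes L (structure)
  assumes add_closed: "\<lbrakk>x \<in> carrier L; y \<in> carrier L\<rbrakk> \<Longrightarrow> x \<oplus> y \<in> carrier L"
    and neg_closed: "x \<in> carrier L \<Longrightarrow> \<sim> x \<in> carrier L"
    and zero_closed: "\<zero> \<in> carrier L"
    and add_assoc: "\<lbrakk>x \<in> carrier L; y \<in> carrier L; z \<in> carrier L\<rbrakk>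
          \<Longrightarrow> (x \<oplus> y) \<oplus> z = x \<oplus> (y \<oplus> z)"
    and add_comm: "\<lbrakk>x \<in> carrier L; y \<in> carrier L\<rbrakk> \<Longrightarrow> x \<oplus> y = y \<oplus> x"
    and zero_add: "x \<in> carrier L \<Longrightarrow> \<zero> \<oplus> x = x"
    and neg_neg: "x \<in> carrier L \<Longrightarrow> \<sim> (\<sim> x) = x"
    and neg_zero_add: "x \<in> carrier L \<Longrightarrow> \<sim> \<zero> \<oplus> x = \<sim> \<zero>"
    and lukasiewicz: "\<lbrakk>x \<in> carrier L; y \<in> carrier L\<rbrakk>
          \<Longrightarrow> \<sim> (\<sim> x \<oplus> y) \<oplus> y = \<sim> (\<sim> y \<oplus> x) \<oplus> x"

definition mv_one :: "('a, 'b) mv_struct_scheme \<Rightarrow> 'a" (\<open>\<one>\<index>\<close>)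
  where "\<one>\<^bsub>L\<^esub> = \<sim>\<^bsub>L\<^esub> \<zero>\<^bsub>L\<^esub>"

definition mv_mult :: "('a, 'b) mv_struct_scheme \<Rightarrow> 'a \<Rightarrow> 'a \<Rightarrow> 'a" (infixl \<open>\<odot>\<index>\<close> 70)
  where "x \<odot>\<^bsub>L\<^esub> y = \<sim>\<^bsub>L\<^esub> (\<sim>\<^bsub>L\<^esub> x \<oplus>\<^bsub>L\<^esub> \<sim>\<^bsub>L\<^esub> y)"

definition boolean_center :: "('a, 'b) mv_struct_scheme \<Rightarrow> 'a set"
  where "boolean_center L = {a \<in> carrier L. a \<oplus>\<^bsub>L\<^esub> a = a}"

definition mv_d :: "('a, 'b) mv_struct_scheme \<Rightarrow> 'a \<Rightarrow> 'a \<Rightarrow> 'a"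
  where "mv_d L a x = x \<odot>\<^bsub>L\<^esub> a"

text \<open>With \<open>b = \<sim> a\<close> this is the map \<open>x \<mapsto> (a \<rightarrow> x)\<close>, where \<open>a \<rightarrow> x = \<sim> a \<oplus> x\<close>.\<close>

definition mv_g :: "('a, 'b) mv_struct_scheme \<Rightarrow> 'a \<Rightarrow> 'a \<Rightarrow> 'a"
  where "mv_g L b x = b \<oplus>\<^bsub>L\<^esub> x"

definition mv_fix :: "('a, 'b) mv_struct_scheme \<Rightarrow> ('a \<Rightarrow> 'a) \<Rightarrow> 'a set"
  where "mv_fix L f = {x \<in> carrier L. f x = x}"

definition fix_d_algebra :: "('a, 'b) mv_struct_scheme \<Rightarrow> 'a \<Rightarrow> 'a mv_struct"
  where "fix_d_algebra L a =
    \<lparr>carrier = mv_fix L (mv_d L a),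
     mv_add = mv_add L,
     mv_neg = (\<lambda>x. mv_d L a (\<sim>\<^bsub>L\<^esub> x)),
     mv_zero = \<zero>\<^bsub>L\<^esub>\<rparr>"

definition fix_g_algebra :: "('a, 'b) mv_struct_scheme \<Rightarrow> 'a \<Rightarrow> 'a mv_struct"
  where "fix_g_algebra L a =
    \<lparr>carrier = mv_fix L (mv_g L (\<sim>\<^bsub>L\<^esub> a)),
     mv_add = mv_add L,
     mv_neg = (\<lambda>x. mv_g L (\<sim>\<^bsub>L\<^esub> a) (\<sim>\<^bsub>L\<^esub> x)),
     mv_zero = \<sim>\<^bsub>L\<^esub> a\<rparr>"

text \<open>The unit is not a field of the structure but the derived constant \<^const>\<open>mv_one\<close>; the next
  two facts identify it as the intended top element of each fixed-point algebra.\<close>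

lemma (in mv_algebra) one_fix_d_algebra:
  assumes "a \<in> carrier L"
  shows "\<one>\<^bsub>fix_d_algebra L a\<^esub> = a"
  using assms
  by (simp add: mv_one_def fix_d_algebra_def mv_d_def mv_mult_def
      neg_neg zero_add zero_closed neg_closed)

lemma (in mv_algebra) one_fix_g_algebra:
  assumes "a \<in> carrier L"
  shows "\<one>\<^bsub>fix_g_algebra L a\<^esub> = \<one>"
proof -
  have one: "\<sim> \<zero> \<in> carrier L"
    by (simp add: zero_closed neg_closed)
  have "\<sim> (\<sim> a \<oplus> \<sim> \<zero>) \<oplus> \<sim> \<zero> = \<sim> (\<sim> (\<sim> \<zero>) \<oplus> a) \<oplus> a"
    by (rule lukasiewicz[OF assms one])
  moreover have "\<sim> (\<sim> a \<oplus> \<sim> \<zero>) \<oplus> \<sim> \<zero> = \<sim> \<zero>"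
    using assms one by (simp add: add_comm[of _ "\<sim> \<zero>"] neg_closed add_closed neg_zero_add)
  ultimately have "\<sim> a \<oplus> a = \<sim> \<zero>"
    using assms by (simp add: neg_neg zero_closed zero_add)
  then show ?thesis
    using assms by (simp add: mv_one_def fix_g_algebra_def mv_g_def neg_neg)
qed

locale mv_hom = A: mv_algebra A + B: mv_algebra B for A (structure) and B (structure) +
  fixes h
  assumes hom_closed: "x \<in> carrier A \<Longrightarrow> h x \<in> carrier B"
    and hom_add: "\<lbrakk>x \<in> carrier A; y \<in> carrier A\<rbrakk>
          \<Longrightarrow> h (x \<oplus>\<^bsub>A\<^esub> y) = h x \<oplus>\<^bsub>B\<^esub> h y"
    and hom_neg: "x \<in> carrier A \<Longrightarrow> h (\<sim>\<^bsub>A\<^esub> x) = \<sim>\<^bsub>B\<^esub> (h x)"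
    and hom_zero: "h \<zero>\<^bsub>A\<^esub> = \<zero>\<^bsub>B\<^esub>"

text \<open>Since \<^const>\<open>mv_hom\<close> includes the axioms for both structures, being isomorphic entails that
  both are MV-algebras.\<close>

definition mv_isomorphic ::
    "('a, 'c) mv_struct_scheme \<Rightarrow> ('b, 'd) mv_struct_scheme \<Rightarrow> bool"
  where "mv_isomorphic A B \<longleftrightarrow> (\<exists>h. mv_hom A B h \<and> bij_betw h (carrier A) (carrier B))"

end

theory Submission
  imports Defs
begin

text \<open>Put \<open>b = \<sim> a\<close>. Idempotency passes from \<open>a\<close> to \<open>b\<close>, and adding an idempotent is joining with
  it. Hence \<open>Fix\<^sub>g\<close> is the up-set of \<open>b\<close> and \<open>Fix\<^sub>d\<close> the down-set of \<open>a\<close>, and the isomorphism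
  is \<open>x \<mapsto> b \<oplus> x\<close> with inverse \<open>y \<mapsto> y \<odot> a\<close>.\<close>

context mv_algebra
begin

section \<open>Elementary arithmetic and the natural order\<close>

lemma add_left_comm:
  assumes "x \<in> carrier L" "y \<in> carrier L" "z \<in> carrier L"
  shows "x \<oplus> (y \<oplus> z) = y \<oplus> (x \<oplus> z)"
  using assms by (metis add_assoc add_comm)

lemmas mv_closed = add_closed neg_closed zero_closed
lemmas mv_ac = add_assoc add_comm add_left_comm

lemma add_zero: "x \<in> carrier L \<Longrightarrow> x \<oplus> \<zero> = x"
  by (metis add_comm zero_add zero_closed)

lemma add_neg_zero: "x \<in> carrier L \<Longrightarrow> x \<oplus> \<sim> \<zero> = \<sim> \<zero>"
  by (metis add_comm neg_zero_add neg_closed zero_closed)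

text \<open>At \<open>y = \<sim> \<zero>\<close> the left side of \<open>lukasiewicz\<close>
  collapses to the absorbing top, while the right side becomes
  \<open>\<sim> x \<oplus> x\<close>.\<close>

lemma neg_add_self:
  assumes "x \<in> carrier L"
  shows "\<sim> x \<oplus> x = \<sim> \<zero>"
  using lukasiewicz[OF assms, of "\<sim> \<zero>"] assms
  by (simp add: mv_closed add_neg_zero neg_neg zero_add)

lemma add_neg_self: "x \<in> carrier L \<Longrightarrow> x \<oplus> \<sim> x = \<sim> \<zero>"
  by (metis add_comm neg_add_self neg_closed)

text \<open>Since \<open>\<sim> x \<oplus> y = \<sim> \<zero>\<close> expresses
  \<open>x \<le> y\<close>, this is antisymmetry of the natural order. Under both hypotheses
  \<open>lukasiewicz\<close> reduces to \<open>y = x\<close>.\<close>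

lemma neg_add_antisym:
  assumes "x \<in> carrier L" "y \<in> carrier L" "\<sim> x \<oplus> y = \<sim> \<zero>" "\<sim> y \<oplus> x = \<sim> \<zero>"
  shows "x = y"
  using lukasiewicz[OF assms(1,2)] assms by (simp add: neg_neg zero_closed zero_add)

section \<open>Idempotents: complements, and sums as joins\<close>

lemma idem_neg:
  assumes a: "a \<in> carrier L" and idem: "a \<oplus> a = a"
  shows "\<sim> a \<oplus> \<sim> a = \<sim> a"
proof (rule neg_add_antisym)
  \<comment> \<open>The axiom trades this for \<open>\<sim> (a \<oplus> a) \<oplus> a\<close>, where
    the idempotency of \<open>a\<close> applies.\<close>
  show "\<sim> (\<sim> a \<oplus> \<sim> a) \<oplus> \<sim> a = \<sim> \<zero>"
    using lukasiewicz[of "\<sim> a" a] a by (simp add: mv_closed neg_neg idem neg_add_self)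
  show "\<sim> (\<sim> a) \<oplus> (\<sim> a \<oplus> \<sim> a) = \<sim> \<zero>"
    using a by (simp add: mv_closed neg_neg add_assoc[symmetric] add_neg_self neg_zero_add)
qed (use a in \<open>simp_all add: mv_closed\<close>)

text \<open>The left side is the lattice join of \<open>b\<close> and \<open>y\<close>. Idempotency
  allows a spare \<open>b\<close> to be added to it, and the other form of the join, which ends in
  \<open>y\<close>, then contains all of \<open>b \<oplus> y\<close> as a summand.\<close>

lemma idem_join:
  assumes b: "b \<in> carrier L" and idem: "b \<oplus> b = b" and y: "y \<in> carrier L"
  shows "\<sim> (\<sim> y \<oplus> b) \<oplus> b = b \<oplus> y"
proof (rule neg_add_antisym)
  let ?j = "\<sim> (\<sim> y \<oplus> b) \<oplus> b"
  have j: "?j = \<sim> (\<sim> b \<oplus> y) \<oplus> y"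
    using lukasiewicz b y by simp
  have "?j = ?j \<oplus> b"
    using b y by (simp add: mv_closed add_assoc idem)
  also have "\<dots> = (b \<oplus> y) \<oplus> \<sim> (\<sim> b \<oplus> y)"
    using b y unfolding j by (simp add: mv_closed mv_ac)
  finally show "\<sim> (b \<oplus> y) \<oplus> ?j = \<sim> \<zero>"
    using b y by (simp add: mv_closed add_assoc[symmetric, of "\<sim> (b \<oplus> y)"] neg_add_self neg_zero_add)
  have "\<sim> ?j \<oplus> (b \<oplus> y) = \<sim> (\<sim> (\<sim> y \<oplus> b) \<oplus> b) \<oplus> b \<oplus> y"
    using b y by (simp add: mv_closed add_assoc)
  \<comment> \<open>The axiom for \<open>\<sim> y \<oplus> b\<close> and \<open>b\<close> brings out
    a summand \<open>\<sim> y\<close>, which the trailing \<open>y\<close> completes to the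
    top.\<close>
  also have "\<dots> = \<sim> (\<sim> b \<oplus> (\<sim> y \<oplus> b)) \<oplus> (\<sim> y \<oplus> b) \<oplus> y"
    using lukasiewicz[of "\<sim> y \<oplus> b" b] b y by (simp add: mv_closed)
  also have "\<dots> = \<sim> (\<sim> b \<oplus> (\<sim> y \<oplus> b)) \<oplus> (b \<oplus> (\<sim> y \<oplus> y))"
    using b y by (simp add: mv_closed mv_ac)
  finally show "\<sim> ?j \<oplus> (b \<oplus> y) = \<sim> \<zero>"
    using b y by (simp add: mv_closed neg_add_self add_neg_zero)
qed (use b y in \<open>simp_all add: mv_closed\<close>)

text \<open>Both equations say \<open>x \<le> a\<close>, because adding \<open>\<sim> a\<close> or
  \<open>a\<close> is joining with it. The left one is what membership in the down-set unfolds to;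
  the right one is convenient for sums.\<close>

lemma idem_absorb_iff:
  assumes a: "a \<in> carrier L" and idem: "a \<oplus> a = a" and x: "x \<in> carrier L"
  shows "\<sim> x \<oplus> \<sim> a = \<sim> x \<longleftrightarrow> x \<oplus> a = a"
proof
  assume "\<sim> x \<oplus> \<sim> a = \<sim> x"
  then have "\<sim> x \<oplus> a = \<sim> x \<oplus> (\<sim> a \<oplus> a)"
    using a x by (metis add_assoc neg_closed)
  then have "\<sim> x \<oplus> a = \<sim> \<zero>"
    using a x by (simp add: mv_closed neg_add_self add_neg_zero)
  then show "x \<oplus> a = a"
    using idem_join[OF a idem x] a x by (simp add: mv_closed neg_neg zero_add add_zero add_comm)
next
  assume "x \<oplus> a = a"
  then have "a \<oplus> \<sim> x = a \<oplus> (x \<oplus> \<sim> x)"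
    using a x by (metis add_assoc add_comm neg_closed)
  then have "a \<oplus> \<sim> x = \<sim> \<zero>"
    using a x by (simp add: mv_closed add_neg_self add_neg_zero)
  \<comment> \<open>The sum is a join by \<open>idem_join\<close>; the axiom swaps it to the form
    containing \<open>a \<oplus> \<sim> x\<close>, just shown to be the top.\<close>
  moreover have "\<sim> a \<oplus> \<sim> x = \<sim> (a \<oplus> \<sim> x) \<oplus> \<sim> x"
    using idem_join[OF neg_closed[OF a] idem_neg[OF a idem], of "\<sim> x"]
      lukasiewicz[of "\<sim> a" "\<sim> x"] a x
    by (simp add: mv_closed neg_neg)
  ultimately show "\<sim> x \<oplus> \<sim> a = \<sim> x"
    using a x by (simp add: mv_closed neg_neg zero_add add_comm[of "\<sim> x"])
qed

text \<open>Negated, this is \<open>(a \<rightarrow> x) \<odot> a = x \<odot> a\<close>. It drives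
  double negation in both fixed-point algebras and both round trips between them.\<close>

lemma idem_neg_join:
  assumes a: "a \<in> carrier L" and idem: "a \<oplus> a = a" and x: "x \<in> carrier L"
  shows "\<sim> (\<sim> a \<oplus> x) \<oplus> \<sim> a = \<sim> x \<oplus> \<sim> a"
  using idem_join[OF neg_closed[OF a] idem_neg[OF a idem], of "\<sim> x"] a x
  by (simp add: mv_closed neg_neg add_comm)

section \<open>Membership and operations of the fixed-point algebras\<close>

lemma mem_fix_d_iff:
  assumes "a \<in> carrier L"
  shows "x \<in> carrier (fix_d_algebra L a) \<longleftrightarrow> x \<in> carrier L \<and> \<sim> x \<oplus> \<sim> a = \<sim> x"
  \<comment> \<open>Negation is an involution, so \<open>x \<odot> a = x\<close> may be negated on
    both sides.\<close>
  using assms by (auto simp: fix_d_algebra_def mv_fix_def mv_d_def mv_mult_def)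
    (metis add_closed neg_closed neg_neg, metis neg_neg)

lemma mem_fix_g_iff:
  "x \<in> carrier (fix_g_algebra L a) \<longleftrightarrow> x \<in> carrier L \<and> \<sim> a \<oplus> x = x"
  by (simp add: fix_g_algebra_def mv_fix_def mv_g_def)

lemma fix_d_add: "x \<oplus>\<^bsub>fix_d_algebra L a\<^esub> y = x \<oplus> y"
  and fix_d_zero: "\<zero>\<^bsub>fix_d_algebra L a\<^esub> = \<zero>"
  by (simp_all add: fix_d_algebra_def)

lemma fix_d_neg:
  assumes "a \<in> carrier L" "x \<in> carrier L"
  shows "\<sim>\<^bsub>fix_d_algebra L a\<^esub> x = \<sim> (\<sim> a \<oplus> x)"
  using assms by (simp add: fix_d_algebra_def mv_d_def mv_mult_def neg_neg neg_closed add_comm)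

lemma fix_g_add: "x \<oplus>\<^bsub>fix_g_algebra L a\<^esub> y = x \<oplus> y"
  and fix_g_zero: "\<zero>\<^bsub>fix_g_algebra L a\<^esub> = \<sim> a"
  and fix_g_neg: "\<sim>\<^bsub>fix_g_algebra L a\<^esub> x = \<sim> a \<oplus> \<sim> x"
  by (simp_all add: fix_g_algebra_def mv_g_def)

section \<open>The MV-algebra axioms on the two fixed-point sets\<close>

lemma mv_algebra_fix_d:
  assumes a: "a \<in> carrier L" and idem: "a \<oplus> a = a"
  shows "mv_algebra (fix_d_algebra L a)"
proof -
  let ?D = "fix_d_algebra L a"
  note mem = mem_fix_d_iff[OF a]
  note ops = fix_d_add fix_d_zero fix_d_neg[OF a]
  have carr: "x \<in> carrier L" if "x \<in> carrier ?D" for x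
    using that by (simp add: mem)
  have absorb: "x \<oplus> a = a" if "x \<in> carrier ?D" for x
    using that idem_absorb_iff[OF a idem, of x] by (simp add: mem)
  have nn: "\<sim> (\<sim> a \<oplus> x) \<oplus> \<sim> a = \<sim> x" if "x \<in> carrier ?D" for x
    using that by (simp add: mem idem_neg_join[OF a idem])
  \<comment> \<open>The term takes the same value as in \<open>L\<close>: the outer negation
    supplies the \<open>\<sim> a\<close> with which \<open>nn\<close> turns the inner one into
    \<open>\<sim> x\<close>. The axiom is thus inherited.\<close>
  have luk: "\<sim>\<^bsub>?D\<^esub> (\<sim>\<^bsub>?D\<^esub> x \<oplus>\<^bsub>?D\<^esub> y) \<oplus>\<^bsub>?D\<^esub> y = \<sim> (\<sim> x \<oplus> y) \<oplus> y"
    if x: "x \<in> carrier ?D" and y: "y \<in> carrier ?D" for x y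
  proof -
    have "\<sim> a \<oplus> (\<sim> (\<sim> a \<oplus> x) \<oplus> y) = \<sim> (\<sim> a \<oplus> x) \<oplus> \<sim> a \<oplus> y"
      using a carr[OF x] carr[OF y] by (simp add: mv_closed mv_ac)
    also have "\<dots> = \<sim> x \<oplus> y"
      by (simp add: nn[OF x])
    finally show ?thesis
      using a carr[OF x] carr[OF y] by (simp add: ops mv_closed)
  qed
  show ?thesis
  proof
    fix x y assume x: "x \<in> carrier ?D" and y: "y \<in> carrier ?D"
    \<comment> \<open>Closure is checked in the form \<open>x \<oplus> a = a\<close>, since
      \<open>a\<close> can absorb the summands one after the other.\<close>
    have "x \<oplus> y \<oplus> a = a"
      using carr[OF x] carr[OF y] a by (simp add: add_assoc absorb[OF x] absorb[OF y])
    then show "x \<oplus>\<^bsub>?D\<^esub> y \<in> carrier ?D"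
      using idem_absorb_iff[OF a idem] carr[OF x] carr[OF y] by (simp add: ops mem add_closed)
    show "x \<oplus>\<^bsub>?D\<^esub> y = y \<oplus>\<^bsub>?D\<^esub> x"
      using carr[OF x] carr[OF y] by (simp add: ops add_comm)
    show "\<sim>\<^bsub>?D\<^esub> (\<sim>\<^bsub>?D\<^esub> x \<oplus>\<^bsub>?D\<^esub> y) \<oplus>\<^bsub>?D\<^esub> y = \<sim>\<^bsub>?D\<^esub> (\<sim>\<^bsub>?D\<^esub> y \<oplus>\<^bsub>?D\<^esub> x) \<oplus>\<^bsub>?D\<^esub> x"
      using lukasiewicz[OF carr[OF x] carr[OF y]] by (simp add: luk x y)
  next
    fix x assume x: "x \<in> carrier ?D"
    note xL = carr[OF x]
    show "\<sim>\<^bsub>?D\<^esub> x \<in> carrier ?D"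
      using a xL idem_neg[OF a idem]
      by (simp add: ops mem mv_closed neg_neg) (metis add_assoc add_comm neg_closed)
    show "\<zero>\<^bsub>?D\<^esub> \<oplus>\<^bsub>?D\<^esub> x = x"
      using xL by (simp add: ops zero_add)
    show "\<sim>\<^bsub>?D\<^esub> (\<sim>\<^bsub>?D\<^esub> x) = x"
      using nn[OF x] a xL by (simp add: ops mv_closed neg_neg add_comm)
    \<comment> \<open>The top here is \<open>a\<close>, so this is \<open>absorb\<close>.\<close>
    show "\<sim>\<^bsub>?D\<^esub> \<zero>\<^bsub>?D\<^esub> \<oplus>\<^bsub>?D\<^esub> x = \<sim>\<^bsub>?D\<^esub> \<zero>\<^bsub>?D\<^esub>"
      using absorb[OF x] a xL by (simp add: ops mv_closed add_zero neg_neg add_comm[of a x])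
  next
    show "\<zero>\<^bsub>?D\<^esub> \<in> carrier ?D"
      using a by (simp add: ops mem mv_closed neg_zero_add)
  next
    fix x y z assume "x \<in> carrier ?D" "y \<in> carrier ?D" "z \<in> carrier ?D"
    then show "x \<oplus>\<^bsub>?D\<^esub> y \<oplus>\<^bsub>?D\<^esub> z = x \<oplus>\<^bsub>?D\<^esub> (y \<oplus>\<^bsub>?D\<^esub> z)"
      by (simp add: ops carr add_assoc)
  qed
qed

lemma mv_algebra_fix_g:
  assumes a: "a \<in> carrier L" and idem: "a \<oplus> a = a"
  shows "mv_algebra (fix_g_algebra L a)"
proof -
  let ?G = "fix_g_algebra L a"
  note mem = mem_fix_g_iff
  note ops = fix_g_add fix_g_zero fix_g_neg
  have carr: "x \<in> carrier L" if "x \<in> carrier ?G" for x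
    using that by (simp add: mem)
  have fix_eq: "\<sim> a \<oplus> x = x" if "x \<in> carrier ?G" for x
    using that by (simp add: mem)
  have idem': "\<sim> a \<oplus> \<sim> a = \<sim> a"
    by (rule idem_neg[OF a idem])
  \<comment> \<open>Again the value is the one in \<open>L\<close>: each negation contributes a
    summand \<open>\<sim> a\<close>, and the fixed point \<open>y\<close> next to it absorbs
    it.\<close>
  have luk: "\<sim>\<^bsub>?G\<^esub> (\<sim>\<^bsub>?G\<^esub> x \<oplus>\<^bsub>?G\<^esub> y) \<oplus>\<^bsub>?G\<^esub> y = \<sim> (\<sim> x \<oplus> y) \<oplus> y"
    if x: "x \<in> carrier ?G" and y: "y \<in> carrier ?G" for x y
  proof -
    have "\<sim> a \<oplus> \<sim> x \<oplus> y = \<sim> x \<oplus> y"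
      using a carr[OF x] carr[OF y] fix_eq[OF y] by (metis add_assoc add_comm neg_closed)
    moreover have "\<sim> a \<oplus> z \<oplus> y = z \<oplus> y" if "z \<in> carrier L" for z
      using a that carr[OF y] fix_eq[OF y] by (metis add_assoc add_comm neg_closed)
    ultimately show ?thesis
      using a carr[OF x] carr[OF y] by (simp add: ops mv_closed)
  qed
  show ?thesis
  proof
    fix x y assume x: "x \<in> carrier ?G" and y: "y \<in> carrier ?G"
    show "x \<oplus>\<^bsub>?G\<^esub> y \<in> carrier ?G"
      using a carr[OF x] carr[OF y]
      by (simp add: ops mem mv_closed add_assoc[symmetric] fix_eq[OF x])
    show "x \<oplus>\<^bsub>?G\<^esub> y = y \<oplus>\<^bsub>?G\<^esub> x"
      using carr[OF x] carr[OF y] by (simp add: ops add_comm)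
    show "\<sim>\<^bsub>?G\<^esub> (\<sim>\<^bsub>?G\<^esub> x \<oplus>\<^bsub>?G\<^esub> y) \<oplus>\<^bsub>?G\<^esub> y = \<sim>\<^bsub>?G\<^esub> (\<sim>\<^bsub>?G\<^esub> y \<oplus>\<^bsub>?G\<^esub> x) \<oplus>\<^bsub>?G\<^esub> x"
      using lukasiewicz[OF carr[OF x] carr[OF y]] by (simp add: luk x y)
  next
    fix x assume x: "x \<in> carrier ?G"
    note xL = carr[OF x]
    show "\<sim>\<^bsub>?G\<^esub> x \<in> carrier ?G"
      using a xL by (simp add: ops mem mv_closed add_assoc[symmetric] idem')
    show "\<zero>\<^bsub>?G\<^esub> \<oplus>\<^bsub>?G\<^esub> x = x"
      by (simp add: ops fix_eq[OF x])
    show "\<sim>\<^bsub>?G\<^esub> (\<sim>\<^bsub>?G\<^esub> x) = x"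
      using idem_neg_join[OF a idem, of "\<sim> x"] a xL fix_eq[OF x]
      by (simp add: ops mv_closed neg_neg add_comm)
    show "\<sim>\<^bsub>?G\<^esub> \<zero>\<^bsub>?G\<^esub> \<oplus>\<^bsub>?G\<^esub> x = \<sim>\<^bsub>?G\<^esub> \<zero>\<^bsub>?G\<^esub>"
      using a xL by (simp add: ops neg_neg neg_add_self neg_zero_add)
  next
    show "\<zero>\<^bsub>?G\<^esub> \<in> carrier ?G"
      using a by (simp add: ops mem mv_closed idem')
  next
    fix x y z assume "x \<in> carrier ?G" "y \<in> carrier ?G" "z \<in> carrier ?G"
    then show "x \<oplus>\<^bsub>?G\<^esub> y \<oplus>\<^bsub>?G\<^esub> z = x \<oplus>\<^bsub>?G\<^esub> (y \<oplus>\<^bsub>?G\<^esub> z)"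
      by (simp add: ops carr add_assoc)
  qed
qed

section \<open>The isomorphism between the two algebras\<close>

lemma mv_hom_fix:
  assumes a: "a \<in> carrier L" and idem: "a \<oplus> a = a"
  shows "mv_hom (fix_d_algebra L a) (fix_g_algebra L a) (mv_g L (\<sim> a))"
proof -
  let ?D = "fix_d_algebra L a" and ?G = "fix_g_algebra L a"
  interpret D: mv_algebra ?D by (rule mv_algebra_fix_d[OF a idem])
  interpret G: mv_algebra ?G by (rule mv_algebra_fix_g[OF a idem])
  note mem = mem_fix_d_iff[OF a] mem_fix_g_iff
  have idem': "\<sim> a \<oplus> (\<sim> a \<oplus> x) = \<sim> a \<oplus> x" if "x \<in> carrier L" for x
    using a that by (simp add: mv_closed add_assoc[symmetric] idem_neg[OF a idem])
  show ?thesis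
  proof
    fix x y assume x: "x \<in> carrier ?D" and y: "y \<in> carrier ?D"
    have xy: "x \<in> carrier L" "y \<in> carrier L"
      using x y by (simp_all add: mem)
    \<comment> \<open>The two summands bring two copies of \<open>\<sim> a\<close>, which
      idempotency merges into the single copy in the image of the sum.\<close>
    have "\<sim> a \<oplus> x \<oplus> (\<sim> a \<oplus> y) = \<sim> a \<oplus> (\<sim> a \<oplus> (x \<oplus> y))"
      using a xy by (simp add: mv_closed mv_ac)
    then show "mv_g L (\<sim> a) (x \<oplus>\<^bsub>?D\<^esub> y) = mv_g L (\<sim> a) x \<oplus>\<^bsub>?G\<^esub> mv_g L (\<sim> a) y"
      using xy by (simp add: mv_g_def fix_d_add fix_g_add idem' add_closed)
  next
    fix x assume x: "x \<in> carrier ?D"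
    then show "mv_g L (\<sim> a) x \<in> carrier ?G"
      using a by (simp add: mem mv_g_def mv_closed idem')
    \<comment> \<open>Both sides unfold to
      \<open>\<sim> a \<oplus> \<sim> (\<sim> a \<oplus> x)\<close>.\<close>
    show "mv_g L (\<sim> a) (\<sim>\<^bsub>?D\<^esub> x) = \<sim>\<^bsub>?G\<^esub> (mv_g L (\<sim> a) x)"
      using a x by (simp add: mem mv_g_def fix_d_neg fix_g_neg)
  next
    show "mv_g L (\<sim> a) \<zero>\<^bsub>?D\<^esub> = \<zero>\<^bsub>?G\<^esub>"
      using a by (simp add: mv_g_def fix_d_zero fix_g_zero mv_closed add_zero)
  qed
qed

lemma bij_betw_fix:
  assumes a: "a \<in> carrier L" and idem: "a \<oplus> a = a"
  shows "bij_betw (mv_g L (\<sim> a)) (carrier (fix_d_algebra L a)) (carrier (fix_g_algebra L a))"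
proof -
  let ?D = "fix_d_algebra L a" and ?G = "fix_g_algebra L a"
  note mem = mem_fix_d_iff[OF a] mem_fix_g_iff
  show ?thesis
  proof (rule bij_betw_byWitness[where f' = "mv_d L a"])
    \<comment> \<open>By \<open>idem_neg_join\<close> the round trip gives
      \<open>x \<odot> a\<close>, which is \<open>x\<close> by membership.\<close>
    show "\<forall>x\<in>carrier ?D. mv_d L a (mv_g L (\<sim> a) x) = x"
      using a by (simp add: mem mv_d_def mv_g_def mv_mult_def idem_neg_join[OF a idem] neg_neg)
    show "\<forall>y\<in>carrier ?G. mv_g L (\<sim> a) (mv_d L a y) = y"
    proof
      fix y assume "y \<in> carrier ?G"
      then have y: "y \<in> carrier L" "y \<oplus> \<sim> a = y"
        using a by (simp_all add: mem add_comm[of y] neg_closed)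
      \<comment> \<open>At \<open>\<sim> y\<close>, \<open>idem_neg_join\<close> reduces the round
        trip to \<open>y \<oplus> \<sim> a\<close>.\<close>
      then show "mv_g L (\<sim> a) (mv_d L a y) = y"
        using idem_neg_join[OF a idem, of "\<sim> y"] a
        by (simp add: mv_d_def mv_g_def mv_mult_def mv_closed neg_neg add_comm)
    qed
    show "mv_g L (\<sim> a) ` carrier ?D \<subseteq> carrier ?G"
      using mv_hom.hom_closed[OF mv_hom_fix[OF a idem]] by blast
    show "mv_d L a ` carrier ?G \<subseteq> carrier ?D"
      using a by (auto simp: mem mv_d_def mv_mult_def mv_closed neg_neg add_assoc
          idem_neg[OF a idem])
  qed
qed

end

theorem theorem4p14:
  fixes L :: "('a, 'b) mv_struct_scheme" and a :: 'a
  assumes "mv_algebra L"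
    and "a \<in> boolean_center L"
  shows "mv_isomorphic (fix_d_algebra L a) (fix_g_algebra L a)"
proof -
  interpret mv_algebra L by fact
  have "a \<in> carrier L" "a \<oplus>\<^bsub>L\<^esub> a = a"
    using assms(2) by (simp_all add: boolean_center_def)
  then show ?thesis
    unfolding mv_isomorphic_def using mv_hom_fix bij_betw_fix by blast
qed

end
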